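(* Let $X$ be an $(n-1)$-dimensional subspace of the space $\ell_\infty^n$ and let $Y$ be an $(n-1)$-dimensional real normed space such that $d(X,Y)\leq 2$. Then $e(Y)\geq\lceil n/2\rceil$.
   Context: For a real finite-dimensional normed space $X$ with norm $\|\cdot\|$, a set $S\subset X$ is called equilateral if there is $p>0$ such that $\|x-y\|=p$ for all $x,y\in S$, $x\neq y$. The equilateral dimension $e(X)$ is the maximal cardinality of an equilateral set in $X$. The (multiplicative) Banach-Mazur distance between normed spaces $X,Y$ of the same finite dimension is $d(X,Y)=\inf\|T\|\cdot\|T^{-1}\|$, the infimum being over all linear invertible operators $T:X\to Y$. $\ell_\infty^n$ is $\mathbb{R}^n$ with the norm $\|x\|_\infty=\max_i|x_i|$; subspaces are linear subspaces with the restricted norm. *)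

theory Defs
  imports "HOL-Analysis.Analysis" "HOL-Library.Extended_Nat"
begin

definition equilateral :: "'a::real_normed_vector set \<Rightarrow> bool" where
  "equilateral S \<longleftrightarrow> (\<exists>p>0. \<forall>x\<in>S. \<forall>y\<in>S. x \<noteq> y \<longrightarrow> norm (x - y) = p)"

text \<open>
  The value lives in \<^typ>\<open>enat\<close> so that the supremum is never a junk value; in a
  finite-dimensional space equilateral sets have bounded size and the supremum is a maximum.
  Finite sets suffice, because subsets of equilateral sets are equilateral.
\<close>

definition equilateral_dim :: "'a::real_normed_vector set \<Rightarrow> enat" where
  "equilateral_dim V = (SUP S\<in>{S. S \<subseteq> V \<and> finite S \<and> equilateral S}. enat (card S))"

text \<open>
  In the following, a normed space is a linear subspace \<open>V\<close> of a real vector space together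
  with a function \<open>N\<close> that is a norm on \<open>V\<close>. The norm is a parameter because
  the norm that the type class provides on \<^typ>\<open>real ^ 'n\<close> is the Euclidean one.
  Only the values of an operator on its domain \<open>V\<close> matter.
\<close>

definition linear_between ::
    "'a::real_vector set \<Rightarrow> 'b::real_vector set \<Rightarrow> ('a \<Rightarrow> 'b) \<Rightarrow> bool" where
  "linear_between V W T \<longleftrightarrow>
     T \<in> V \<rightarrow> W \<and>
     (\<forall>x\<in>V. \<forall>y\<in>V. T (x + y) = T x + T y) \<and>
     (\<forall>c. \<forall>x\<in>V. T (c *\<^sub>R x) = c *\<^sub>R T x)"

text \<open>
  The vector \<open>0 \<in> V\<close> contributes \<open>0 / 0 = 0\<close>, so operators on the zero space have norm \<open>0\<close>.
\<close>

definition op_norm ::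
    "'a::real_vector set \<Rightarrow> ('a \<Rightarrow> real) \<Rightarrow> ('b::real_vector \<Rightarrow> real) \<Rightarrow> ('a \<Rightarrow> 'b) \<Rightarrow> real" where
  "op_norm V N M T = (SUP x\<in>V. M (T x) / N x)"

text \<open>
  Meant for spaces of the same finite dimension, where the infimum ranges over a nonempty set
  of nonnegative reals.
\<close>

definition banach_mazur_dist ::
    "'a::real_vector set \<Rightarrow> ('a \<Rightarrow> real) \<Rightarrow> 'b::real_vector set \<Rightarrow> ('b \<Rightarrow> real) \<Rightarrow> real" where
  "banach_mazur_dist V N W M =
     (INF T\<in>{T. linear_between V W T \<and> bij_betw T V W}.
        op_norm V N M T * op_norm W M N (inv_into V T))"

end

theory Submission imports Defs begin

text \<open>
  Grouping the coordinates into pairs, a hyperplane of \<open>\<ell>\<^sub>\<infinity>\<^sup>n\<close> contains an isometric copy of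
  \<open>\<ell>\<^sub>\<infinity>\<^sup>m\<close> with \<open>m = \<lfloor>n/2\<rfloor>\<close>. By compactness the Banach-Mazur distance is attained, so
  \<open>Y\<close> contains an \<open>m\<close>-dimensional subspace whose norm is within the factor 2 of \<open>\<ell>\<^sub>\<infinity>\<^sup>m\<close>.
  Brouwer's theorem then perturbs an equilateral set of \<open>m + 1\<close> points of \<open>\<ell>\<^sub>\<infinity>\<^sup>m\<close> into one of
  \<open>Y\<close>, and \<open>m + 1 \<ge> \<lceil>n/2\<rceil>\<close>.
\<close>

section \<open>Linear maps on finite-dimensional spaces\<close>

text \<open>The norm of \<open>f x\<close> attains its minimum on the compact unit sphere of
  \<open>S\<close>, injectivity makes it positive, and homogeneity extends the bound.\<close>

lemma linear_bounded_below_on: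
  fixes f :: "'a::euclidean_space \<Rightarrow> 'b::real_normed_vector"
  assumes f: "linear f" and S: "subspace S" and inj: "\<And>x. x \<in> S \<Longrightarrow> f x = 0 \<Longrightarrow> x = 0"
  obtains e where "e > 0" "\<And>x. x \<in> S \<Longrightarrow> e * norm x \<le> norm (f x)"
proof (cases "S \<subseteq> {0}")
  case True
  then show ?thesis
    by (intro that[of 1]) (auto simp: linear_0[OF f])
next
  case False
  let ?C = "S \<inter> sphere 0 1"
  have "compact ?C"
    using closed_subspace[OF S] by (simp add: closed_Int_compact)
  moreover obtain z where z: "z \<in> S" "z \<noteq> 0"
    using False by blast
  then have "z /\<^sub>R norm z \<in> ?C"
    using S by (simp add: subspace_scale)
  moreover have "continuous_on ?C (\<lambda>x. norm (f x))"
    using f by (intro continuous_intros linear_continuous_on) (simp add: linear_linear)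
  ultimately obtain y where y: "y \<in> ?C" and min: "\<And>x. x \<in> ?C \<Longrightarrow> norm (f y) \<le> norm (f x)"
    using continuous_attains_inf[of ?C "\<lambda>x. norm (f x)"] by blast
  show ?thesis
  proof (rule that)
    show "norm (f y) > 0"
      using y inj[of y] by auto
    fix x assume x: "x \<in> S"
    show "norm (f y) * norm x \<le> norm (f x)"
    proof (cases "x = 0")
      case False
      then have "norm (f y) \<le> norm (f (x /\<^sub>R norm x))"
        using x S by (intro min) (simp add: subspace_scale)
      also have "\<dots> = norm (f x) / norm x"
        by (simp add: linear_cmul[OF f] divide_inverse)
      finally show ?thesis
        using False by (simp add: field_simps)
    qed (use linear_0[OF f] in simp)
  qed
qed

text \<open>\<open>'b\<close> has a finite spanning set but need not be Euclidean; \<open>G\<close>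
  and \<open>K\<close> transport compactness arguments to \<open>X\<close>. Both are linear on the
  whole type, so they compose freely.\<close>

lemma linear_isomorphism_onto_UNIV:
  fixes X :: "'a::euclidean_space set"
  assumes X: "subspace X"
    and fin: "\<exists>B :: 'b::real_vector set. finite B \<and> span B = UNIV"
    and dim: "dim X = dim (UNIV :: 'b set)"
  obtains G :: "'a \<Rightarrow> 'b::real_vector" and K :: "'b \<Rightarrow> 'a"
  where "linear G" "linear K" "\<And>y. K y \<in> X" "\<And>y. G (K y) = y" "\<And>x. x \<in> X \<Longrightarrow> K (G x) = x"
proof -
  obtain B where B: "B \<subseteq> X" "independent B" "X \<subseteq> span B" "card B = dim X"
    by (rule basis_exists)
  obtain C :: "'b set" where C: "independent C" "UNIV \<subseteq> span C" "card C = dim (UNIV :: 'b set)"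
    using basis_exists[of "UNIV :: 'b set"] by metis
  have "finite C"
    using fin independent_span_bound C(1) by (metis subset_UNIV)
  moreover have "finite B"
    using B(2) by (rule independent_imp_finite)
  ultimately obtain f where f: "bij_betw f B C"
    using B(4) C(3) dim by (metis finite_same_card_bij)
  obtain G where G: "linear G" "\<forall>x\<in>B. G x = f x"
    using linear_independent_extend[OF B(2)] by blast
  obtain K where K: "linear K" "\<forall>y\<in>C. K y = inv_into B f y" "range K = span (inv_into B f ` C)"
    using linear_independent_extend_subspace[OF C(1)] by blast
  have "inv_into B f ` C = B"
    using f by (metis bij_betw_imp_surj_on bij_betw_inv_into)
  then have "range K \<subseteq> X"
    using K(3) B(1) X by (simp add: span_minimal)
  moreover have "(G \<circ> K) y = id y" for y
  proof (rule linear_eq_on[of "G \<circ> K" id y C])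
    show "y \<in> span C" using C(2) by blast
    show "(G \<circ> K) b = id b" if "b \<in> C" for b
      using that f G(2) K(2)
      by (simp add: bij_betw_inv_into_right) (metis bij_betw_inv_into bij_betwE bij_betw_inv_into_right)
  qed (use G K linear_compose in \<open>auto simp: linear_id\<close>)
  moreover have "(K \<circ> G) x = id x" if "x \<in> X" for x
  proof (rule linear_eq_on[of "K \<circ> G" id x B])
    show "x \<in> span B" using B(3) that by blast
    show "(K \<circ> G) b = id b" if "b \<in> B" for b
      using that f G(2) K(2) by (simp add: bij_betw_inv_into_left bij_betw_apply)
  qed (use G K linear_compose in \<open>auto simp: linear_id\<close>)
  ultimately show ?thesis
    using G(1) K(1) by (intro that[of G K]) auto
qed

section \<open>The Banach-Mazur distance and its attainment\<close>

text \<open>A real supremum is known to dominate its set only if that set is bounded above; any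
  constant \<open>C\<close>, however crude, guarantees this.\<close>

lemma op_norm_bound:
  assumes bdd: "\<And>x. x \<in> V \<Longrightarrow> M (T x) \<le> C * N x"
    and nonneg: "\<And>x. x \<in> V \<Longrightarrow> N x \<ge> 0" and x: "x \<in> V"
  shows "M (T x) \<le> op_norm V N M T * N x"
proof (cases "N x = 0")
  case False
  \<comment> \<open>The maximum with 0 covers \<open>N y = 0\<close>, where the quotient is 0 by
    convention while \<open>C\<close> may be negative.\<close>
  have "M (T y) / N y \<le> max C 0" if "y \<in> V" for y
    using bdd[OF that] nonneg[OF that]
    by (cases "N y = 0") (auto simp: pos_divide_le_eq le_max_iff_disj intro: order.trans)
  then have "bdd_above ((\<lambda>x. M (T x) / N x) ` V)"
    by (rule bdd_aboveI2)
  then have "M (T x) / N x \<le> op_norm V N M T"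
    unfolding op_norm_def using x by (rule cSUP_upper2[OF _ _ order.refl])
  then show ?thesis
    using False nonneg[OF x] by (simp add: pos_divide_le_eq)
qed (use bdd[OF x] in simp)

text \<open>An infimum below \<open>D\<close> yields an operator whose product of norms is below
  \<open>D\<close>; dividing it by its own norm shifts the whole product to the inverse.\<close>

lemma banach_mazur_approx:
  fixes X :: "'a::euclidean_space set" and G :: "'a \<Rightarrow> 'b::real_normed_vector"
  assumes X: "subspace X" and G: "linear G" and K: "linear K"
    and KX: "\<And>y. K y \<in> X" and GK: "\<And>y. G (K y) = y" and KG: "\<And>x. x \<in> X \<Longrightarrow> K (G x) = x"
    and dist: "banach_mazur_dist X infnorm (UNIV :: 'b set) norm < D"
  obtains T :: "'a \<Rightarrow> 'b" where "linear T" "\<And>x. x \<in> X \<Longrightarrow> norm (T x) \<le> infnorm x"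
    "\<And>x. x \<in> X \<Longrightarrow> infnorm x \<le> D * norm (T x)"
proof -
  let ?\<T> = "{T. linear_between X (UNIV :: 'b set) T \<and> bij_betw T X UNIV}"
  have "bij_betw G X UNIV"
    by (rule bij_betw_byWitness[of _ K]) (use KX GK KG in auto)
  \<comment> \<open>\<open>G\<close> shows that the infimum ranges over a nonempty set; otherwise
    its value would carry no information.\<close>
  then have "G \<in> ?\<T>"
    using G by (simp add: linear_between_def linear_add linear_cmul)
  then have "(\<lambda>T. op_norm X infnorm norm T * op_norm UNIV norm infnorm (inv_into X T)) ` ?\<T> \<noteq> {}"
    by blast
  from cInf_lessD[OF this dist[unfolded banach_mazur_dist_def]]
  obtain T :: "'a \<Rightarrow> 'b" where T: "linear_between X UNIV T" "bij_betw T X UNIV"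
    and lt: "op_norm X infnorm norm T * op_norm UNIV norm infnorm (inv_into X T) < D"
    by blast
  let ?a = "op_norm X infnorm norm T" and ?b = "op_norm UNIV norm infnorm (inv_into X T)"
  \<comment> \<open>\<open>T\<close> is linear only on \<open>X\<close>; composing it with the
    projection \<open>K \<circ> G\<close> onto \<open>X\<close> gives a globally linear map that
    agrees with it there.\<close>
  define S where "S = T \<circ> K \<circ> G"
  have S: "linear S"
    using T(1) KX G K
    by (intro linearI) (auto simp: S_def linear_between_def linear_add linear_cmul)
  have ST: "S x = T x" if "x \<in> X" for x
    using KG that by (simp add: S_def)
  have S0: "x = 0" if "x \<in> X" "S x = 0" for x
    using that T(2) ST S X by (metis bij_betw_def inj_onD linear_0 subspace_0)
  obtain B where B: "B > 0" "\<And>x. norm (S x) \<le> B * norm x"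
    using linear_bounded_pos[OF S] by blast
  obtain e where e: "e > 0" "\<And>x. x \<in> X \<Longrightarrow> e * norm x \<le> norm (S x)"
    using linear_bounded_below_on[OF S X S0] by blast
  have a: "norm (T x) \<le> ?a * infnorm x" if "x \<in> X" for x
  proof (rule op_norm_bound[OF _ _ that])
    fix y assume "y \<in> X"
    have "norm (S y) \<le> B * norm y"
      by (rule B)
    also have "\<dots> \<le> B * (sqrt DIM('a) * infnorm y)"
      using B(1) norm_le_infnorm by (intro mult_left_mono) auto
    finally show "norm (T y) \<le> (B * sqrt DIM('a)) * infnorm y"
      using ST[OF \<open>y \<in> X\<close>] by (simp add: mult.assoc)
  qed (rule infnorm_pos_le)
  have b: "infnorm x \<le> ?b * norm (T x)" if "x \<in> X" for x
  proof -
    have inv: "inv_into X T (T y) = y" if "y \<in> X" for y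
      using T(2) that by (rule bij_betw_inv_into_left)
    have "infnorm (inv_into X T (T x)) \<le> ?b * norm (T x)"
    proof (rule op_norm_bound)
      fix y :: 'b
      obtain z where z: "z \<in> X" "y = T z"
        using T(2) by (metis UNIV_I bij_betw_imp_surj_on imageE)
      have "norm z \<le> (1 / e) * norm y"
        using e(1) e(2)[OF z(1)] z(2) ST[OF z(1)] by (simp add: field_simps)
      then show "infnorm (inv_into X T y) \<le> (1 / e) * norm y"
        unfolding z(2) inv[OF z(1)] by (rule order.trans[OF infnorm_le_norm])
    qed auto
    then show ?thesis
      using inv that by simp
  qed
  show ?thesis
  \<comment> \<open>On the zero space the operator norm is 0, so rescaling by it is
    impossible.\<close>
  proof (cases "X \<subseteq> {0}")
    case True
    then show ?thesis
      using linear_0[OF S] by (intro that[OF S]) (auto simp: infnorm_0)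
  next
    case False
    then obtain z where z: "z \<in> X" "z \<noteq> 0" by blast
    then have "norm (T z) > 0"
      using S0 ST by force
    with a[OF z(1)] have "0 < ?a * infnorm z"
      by linarith
    then have "?a > 0"
      using infnorm_pos_le[of z] by (simp add: zero_less_mult_iff)
    show ?thesis
    proof (rule that[of "\<lambda>x. S x /\<^sub>R ?a"])
      show "linear (\<lambda>x. S x /\<^sub>R ?a)"
        using S by (rule linear_compose_scale_right)
      fix x assume x: "x \<in> X"
      show "norm (S x /\<^sub>R ?a) \<le> infnorm x"
        using a[OF x] \<open>?a > 0\<close> ST[OF x] by (simp add: field_simps)
      have "infnorm x \<le> (?a * ?b) * norm (S x /\<^sub>R ?a)"
        using b[OF x] \<open>?a > 0\<close> ST[OF x] by (simp add: field_simps)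
      also have "\<dots> \<le> D * norm (S x /\<^sub>R ?a)"
        using lt by (intro mult_right_mono) auto
      finally show "infnorm x \<le> D * norm (S x /\<^sub>R ?a)" .
    qed
  qed
qed

text \<open>Operators with constants \<open>D + 1 / (j + 1)\<close> form a bounded sequence in a
  finite-dimensional space; the limit of a convergent subsequence has constant
  \<open>D\<close>.\<close>

lemma banach_mazur_attained:
  fixes X :: "'a::euclidean_space set"
  assumes X: "subspace X"
    and fin: "\<exists>B :: 'b::real_normed_vector set. finite B \<and> span B = UNIV"
    and dim: "dim X = dim (UNIV :: 'b set)"
    and dist: "banach_mazur_dist X infnorm (UNIV :: 'b set) norm \<le> D"
  obtains T :: "'a \<Rightarrow> 'b::real_normed_vector" where "linear T" "\<And>x. x \<in> X \<Longrightarrow> norm (T x) \<le> infnorm x"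
    "\<And>x. x \<in> X \<Longrightarrow> infnorm x \<le> D * norm (T x)"
proof -
  obtain G :: "'a \<Rightarrow> 'b" and K where G: "linear G" and K: "linear K"
    and KX: "\<And>y. K y \<in> X" and GK: "\<And>y. G (K y) = y" and KG: "\<And>x. x \<in> X \<Longrightarrow> K (G x) = x"
    using linear_isomorphism_onto_UNIV[OF X fin dim] by blast
  have "\<exists>T :: 'a \<Rightarrow> 'b. linear T \<and> (\<forall>x\<in>X. norm (T x) \<le> infnorm x) \<and>
    (\<forall>x\<in>X. infnorm x \<le> (D + inverse (real (Suc j))) * norm (T x))" for j
  proof -
    have "banach_mazur_dist X infnorm (UNIV :: 'b set) norm < D + inverse (real (Suc j))"
      using dist by (rule order.strict_trans1) simp
    then show ?thesis
      using banach_mazur_approx[OF X G K KX GK KG] by metis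
  qed
  then obtain T :: "nat \<Rightarrow> 'a \<Rightarrow> 'b" where T: "\<And>j. linear (T j)"
    and T1: "\<And>j x. x \<in> X \<Longrightarrow> norm (T j x) \<le> infnorm x"
    and T2: "\<And>j x. x \<in> X \<Longrightarrow> infnorm x \<le> (D + inverse (real (Suc j))) * norm (T j x)"
    by metis
  \<comment> \<open>As operators on the Euclidean space \<open>'a\<close> these maps admit
    Bolzano-Weierstrass. On \<open>X\<close> the inner \<open>K \<circ> G\<close> is the identity,
    and applying \<open>G\<close> to \<open>A j\<close> recovers \<open>T j\<close>.\<close>
  define A where "A j = Blinfun (K \<circ> T j \<circ> K \<circ> G)" for j
  have A: "blinfun_apply (A j) = K \<circ> T j \<circ> K \<circ> G" for j
    unfolding A_def by (rule bounded_linear_Blinfun_apply)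
      (auto simp flip: linear_conv_bounded_linear intro!: linear_compose G K T)
  obtain e where e: "e > 0" "\<And>x. x \<in> X \<Longrightarrow> e * norm x \<le> norm (G x)"
    using linear_bounded_below_on[OF G X] KG linear_0[OF K] by metis
  obtain B where B: "B > 0" "\<And>x. norm (G x) \<le> B * norm x"
    using linear_bounded_pos[OF G] by blast
  have Kb: "norm (K y) \<le> norm y / e" for y
    using e(2)[OF KX, of y] e(1) by (simp add: GK field_simps)
  \<comment> \<open>Each \<open>K\<close> costs a factor \<open>1 / e\<close>, \<open>G\<close> a
    factor \<open>B\<close>, and \<open>T j\<close> none, since \<open>infnorm\<close> is at most
    the Euclidean norm.\<close>
  have "norm (A j) \<le> B / e / e" for j
  proof (rule norm_blinfun_bound)
    fix x
    have "norm (A j x) \<le> norm (T j (K (G x))) / e"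
      using Kb by (simp add: A)
    also have "\<dots> \<le> norm (K (G x)) / e"
      using T1[OF KX] infnorm_le_norm e(1) by (meson divide_right_mono less_imp_le order_trans)
    also have "\<dots> \<le> (norm (G x) / e) / e"
      using e(1) by (intro divide_right_mono Kb) simp
    also have "\<dots> \<le> B / e / e * norm x"
      using B(2)[of x] e(1) by (simp add: divide_right_mono)
    finally show "norm (A j x) \<le> B / e / e * norm x" .
  qed (use B e in simp)
  then have "bounded (range A)"
    by (auto simp: bounded_iff)
  then obtain L r where r: "strict_mono (r :: nat \<Rightarrow> nat)" and L: "(A \<circ> r) \<longlonglongrightarrow> L"
    using bounded_imp_convergent_subsequence by blast
  have lim: "(\<lambda>j. T (r j) x) \<longlonglongrightarrow> G (L x)" if "x \<in> X" for x
  proof -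
    have "(\<lambda>j. (A \<circ> r) j x) \<longlonglongrightarrow> L x"
      by (intro tendsto_intros L)
    then have "(\<lambda>j. G ((A \<circ> r) j x)) \<longlonglongrightarrow> G (L x)"
      using G bounded_linear.tendsto[of G] by (simp add: linear_linear)
    then show ?thesis
      using that by (simp add: A GK KG)
  qed
  show ?thesis
  proof (rule that[of "G \<circ> L"])
    show "linear (G \<circ> L)"
      by (intro linear_compose G bounded_linear.linear[OF blinfun.bounded_linear_right])
    fix x assume x: "x \<in> X"
    show "norm ((G \<circ> L) x) \<le> infnorm x"
      using tendsto_norm[OF lim[OF x]] T1[OF x] by (auto intro: tendsto_upperbound)
    have "(\<lambda>j. inverse (real (Suc (r j)))) \<longlonglongrightarrow> 0"
      using LIMSEQ_subseq_LIMSEQ[OF LIMSEQ_inverse_real_of_nat r] by (simp add: o_def)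
    then have "(\<lambda>j. (D + inverse (real (Suc (r j)))) * norm (T (r j) x)) \<longlonglongrightarrow> (D + 0) * norm (G (L x))"
      by (intro tendsto_intros lim x)
    then show "infnorm x \<le> D * norm ((G \<circ> L) x)"
      using T2[OF x] by (auto intro: tendsto_lowerbound)
  qed
qed

section \<open>Embedding a maximum-norm space into a hyperplane\<close>

lemma infnorm_cart_le:
  fixes x :: "real ^ 'n"
  assumes "\<And>i. \<bar>x $ i\<bar> \<le> r"
  shows "infnorm x \<le> r"
  unfolding infnorm_cart by (rule cSup_least) (use assms in auto)

text \<open>
  Each pair of coordinates carries a vector of the hyperplane with entries at most 1 in modulus,
  namely 1 at the coordinate where \<open>a\<close> is smaller in modulus.
\<close>

lemma hyperplane_contains_linf:
  fixes a :: "real ^ 'n::finite"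
  obtains u :: "nat \<Rightarrow> real ^ 'n" where "\<And>k. k < CARD('n) div 2 \<Longrightarrow> a \<bullet> u k = 0"
    "\<And>c r. 0 \<le> r \<Longrightarrow> (\<And>k. k < CARD('n) div 2 \<Longrightarrow> \<bar>c k\<bar> \<le> r) \<Longrightarrow>
      infnorm (\<Sum>k<CARD('n) div 2. c k *\<^sub>R u k) \<le> r"
    "\<And>c k. k < CARD('n) div 2 \<Longrightarrow> \<bar>c k\<bar> \<le> infnorm (\<Sum>k<CARD('n) div 2. c k *\<^sub>R u k)"
proof -
  let ?M = "CARD('n) div 2"
  obtain h :: "nat \<Rightarrow> 'n" where h: "bij_betw h {0..<CARD('n)} UNIV"
    using ex_bij_betw_nat_finite[of "UNIV :: 'n set"] by auto
  have hinj: "h i = h j \<longleftrightarrow> i = j" if "i < CARD('n)" "j < CARD('n)" for i j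
    using h that by (auto simp: bij_betw_def inj_on_def)
  have "\<exists>i j. {i, j} = {2*k, 2*k+1} \<and> i \<noteq> j \<and> \<bar>a $ h i\<bar> \<le> \<bar>a $ h j\<bar>" for k :: nat
  proof (cases "\<bar>a $ h (2*k)\<bar> \<le> \<bar>a $ h (2*k+1)\<bar>")
    case True
    then show ?thesis
      by (intro exI[of _ "2*k"] exI[of _ "2*k+1"]) simp
  next
    case False
    then show ?thesis
      by (intro exI[of _ "2*k+1"] exI[of _ "2*k"]) auto
  qed
  then obtain p q where pq: "\<And>k. {p k, q k} = {2*k, 2*k+1::nat}" "\<And>k. p k \<noteq> q k"
    "\<And>k. \<bar>a $ h (p k)\<bar> \<le> \<bar>a $ h (q k)\<bar>"
    by metis
  have div: "p k div 2 = k" "q k div 2 = k" for k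
    using pq(1)[of k] by (auto simp: doubleton_eq_iff)
  have lt: "p k < CARD('n)" "q k < CARD('n)" if "k < ?M" for k
    using div[of k] that by (metis div_le_mono leD linorder_le_less_linear)+
  \<comment> \<open>The second entry cancels the first in the product with \<open>a\<close>. If its
    denominator is 0, so is the numerator, and the value \<open>0 / 0 = 0\<close> still gives
    orthogonality.\<close>
  define u :: "nat \<Rightarrow> real ^ 'n" where "u k = axis (h (p k)) 1 - (a $ h (p k) / a $ h (q k)) *\<^sub>R axis (h (q k)) 1" for k
  have u: "u k $ h i = (if i = p k then 1 else if i = q k then - (a $ h (p k) / a $ h (q k)) else 0)"
    if "k < ?M" "i < CARD('n)" for k i
    using that lt[OF that(1)] pq(2)[of k] by (auto simp: u_def axis_def hinj)
  \<comment> \<open>The supports are disjoint, so only the term of the pair containing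
    \<open>i\<close> survives; for odd dimension the last coordinate lies in no pair.\<close>
  have sum: "(\<Sum>k<?M. c k *\<^sub>R u k) $ h i = (if i div 2 < ?M then c (i div 2) * u (i div 2) $ h i else 0)"
    if "i < CARD('n)" for c i
  proof -
    have "(\<Sum>k<?M. c k *\<^sub>R u k) $ h i = (\<Sum>k<?M. if k = i div 2 then c k * u k $ h i else 0)"
      unfolding sum_component using that div by (intro sum.cong) (auto simp: u)
    then show ?thesis
      by simp
  qed
  show ?thesis
  proof (rule that)
    fix k assume "k < ?M"
    show "a \<bullet> u k = 0"
      using pq(3)[of k] by (cases "a $ h (q k) = 0") (auto simp: u_def inner_diff_right inner_axis)
  next
    fix c :: "nat \<Rightarrow> real" and r :: real
    assume r: "0 \<le> r" and c: "\<And>k. k < ?M \<Longrightarrow> \<bar>c k\<bar> \<le> r"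
    show "infnorm (\<Sum>k<?M. c k *\<^sub>R u k) \<le> r"
    proof (rule infnorm_cart_le)
      fix x :: 'n
      obtain i where i: "i < CARD('n)" "x = h i"
        using h by (metis UNIV_I atLeastLessThan_iff bij_betw_imp_surj_on imageE)
      have le: "\<bar>u k $ h i\<bar> \<le> 1" if "k < ?M" for k
        using pq(3)[of k] unfolding u[OF that i(1)]
        by (cases "a $ h (q k) = 0") (auto simp: abs_divide)
      show "\<bar>(\<Sum>k<?M. c k *\<^sub>R u k) $ x\<bar> \<le> r"
        using mult_mono[OF c le, of "i div 2" "i div 2"] r by (simp add: i sum abs_mult del: sum_component)
    qed
  next
    fix c :: "nat \<Rightarrow> real" and k assume k: "k < ?M"
    \<comment> \<open>At the coordinate \<open>h (p k)\<close> the sum has the entry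
      \<open>c k\<close>.\<close>
    show "\<bar>c k\<bar> \<le> infnorm (\<Sum>k<?M. c k *\<^sub>R u k)"
      using component_le_infnorm_cart[of "\<Sum>k<?M. c k *\<^sub>R u k" "h (p k)"] k lt[OF k]
      by (simp add: sum u div del: sum_component)
  qed
qed

section \<open>Equilateral sets from Brouwer's fixed point theorem\<close>

text \<open>
  In \<open>\<ell>\<^sub>\<infinity>\<^sup>M\<close> the points \<open>p\<^sub>j = - v\<^sub>j + (\<Sum>i<j. x\<^sub>i\<^sub>j v\<^sub>i)\<close> (without \<open>v\<^sub>j\<close> if \<open>j = M\<close>) have distances
  \<open>1 + x\<^sub>i\<^sub>j\<close> when all \<open>x\<^sub>i\<^sub>j \<in> [0, 1]\<close>. Hence the map
  \<open>x\<^sub>i\<^sub>j \<mapsto> 1 + x\<^sub>i\<^sub>j - norm (p\<^sub>i - p\<^sub>j)\<close> preserves the cube, and at a fixed point all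
  distances are 1. The type \<open>'n\<close> only serves to index the coordinates of that cube.
\<close>

lemma equilateral_of_linf_distance_2:
  fixes v :: "nat \<Rightarrow> 'b::real_normed_vector"
  assumes M: "M < CARD('n::finite)"
    and upper: "\<And>c r. 0 \<le> r \<Longrightarrow> (\<And>k. k < M \<Longrightarrow> \<bar>c k\<bar> \<le> r) \<Longrightarrow> norm (\<Sum>k<M. c k *\<^sub>R v k) \<le> r"
    and lower: "\<And>c k. k < M \<Longrightarrow> \<bar>c k\<bar> \<le> 2 * norm (\<Sum>k<M. c k *\<^sub>R v k)"
  obtains S :: "'b set" where "finite S" "card S = Suc M" "equilateral S"
proof -
  obtain h :: "nat \<Rightarrow> 'n" where h: "bij_betw h {0..<CARD('n)} UNIV"
    using ex_bij_betw_nat_finite[of "UNIV :: 'n set"] by auto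
  define g where "g = inv_into {0..<CARD('n)} h"
  have gh: "g (h i) = i" if "i < CARD('n)" for i
    using h that by (simp add: g_def bij_betw_inv_into_left)
  define c :: "real ^ ('n \<times> 'n) \<Rightarrow> nat \<Rightarrow> nat \<Rightarrow> real" where
    "c x j k = (if k < j then x $ (h k, h j) else if k = j then - 1 else 0)" for x j k
  define p where "p x j = (\<Sum>k<M. c x j k *\<^sub>R v k)" for x j
  \<comment> \<open>Only pairs \<open>i < j \<le> M\<close> matter; the remaining coordinates of the
    cube are dummies sent to 0.\<close>
  define f :: "real ^ ('n \<times> 'n) \<Rightarrow> real ^ ('n \<times> 'n)" where
    "f x = (\<chi> ab. if g (fst ab) < g (snd ab) \<and> g (snd ab) \<le> M
       then 1 + x $ ab - norm (p x (g (fst ab)) - p x (g (snd ab))) else 0)" for x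
  let ?Q = "cbox 0 1 :: (real ^ ('n \<times> 'n)) set"
  have hg: "h (g a) = a" for a
    using h by (simp add: g_def bij_betw_inv_into_right)
  have diff: "norm (p x i - p x j) \<le> 1 + x $ (h i, h j) \<and>
      1 + x $ (h i, h j) \<le> 2 * norm (p x i - p x j)"
    if x: "x \<in> ?Q" and ij: "i < j" "j \<le> M" for x i j
  proof -
    have x01: "0 \<le> x $ ab" "x $ ab \<le> 1" for ab
      using x by (auto simp: mem_box_cart simp del: split_paired_All)
    have eq: "p x i - p x j = (\<Sum>k<M. (c x i k - c x j k) *\<^sub>R v k)"
      by (simp add: p_def scaleR_diff_left sum_subtractf)
    \<comment> \<open>Below \<open>i\<close> both coefficients lie in \<open>[0, 1]\<close>; at
      \<open>i\<close> they are \<open>- 1\<close> and the entry of \<open>x\<close> at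
      \<open>(h i, h j)\<close>; beyond \<open>i\<close> the first one is 0 and the second has
      modulus at most 1.\<close>
    have "\<bar>c x i k - c x j k\<bar> \<le> 1 + x $ (h i, h j)" for k
      using ij x01[of "(h k, h i)"] x01[of "(h k, h j)"] x01[of "(h i, h j)"]
      unfolding c_def abs_le_iff
      by (cases k i rule: linorder_cases; cases k j rule: linorder_cases) simp_all
    then have "norm (p x i - p x j) \<le> 1 + x $ (h i, h j)"
      unfolding eq using x01[of "(h i, h j)"] by (intro upper) auto
    \<comment> \<open>The bound is attained at coordinate \<open>i\<close>, which is below
      \<open>M\<close> even when \<open>j = M\<close>, so \<open>lower\<close> applies
      there.\<close>
    moreover have "1 + x $ (h i, h j) = \<bar>c x i i - c x j i\<bar>"
      using ij x01[of "(h i, h j)"] by (simp add: c_def)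
    ultimately show ?thesis
      using lower[of i "\<lambda>k. c x i k - c x j k"] ij unfolding eq by simp
  qed
  have cont: "continuous_on ?Q f"
  proof -
    have "continuous_on ?Q (\<lambda>x. c x j k)" for j k
      unfolding c_def by (cases "k < j"; cases "k = j") (simp_all add: continuous_on_component)
    then have p: "continuous_on ?Q (\<lambda>x. p x j)" for j
      unfolding p_def by (simp add: continuous_on_sum continuous_on_scaleR)
    show ?thesis
      unfolding f_def
    proof (rule continuous_on_vec_lambda)
      fix ab :: "'n \<times> 'n"
      show "continuous_on ?Q (\<lambda>x. if g (fst ab) < g (snd ab) \<and> g (snd ab) \<le> M
        then 1 + x $ ab - norm (p x (g (fst ab)) - p x (g (snd ab))) else 0)"
      proof (cases "g (fst ab) < g (snd ab) \<and> g (snd ab) \<le> M")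
        case True
        then show ?thesis
          by (simp add: continuous_on_add continuous_on_diff continuous_on_norm
              continuous_on_component p)
      qed (simp only: if_False continuous_on_const)
    qed
  qed
  have "f x \<in> ?Q" if x: "x \<in> ?Q" for x
  proof -
    have "0 \<le> f x $ ab \<and> f x $ ab \<le> 1" for ab
    proof (cases "g (fst ab) < g (snd ab) \<and> g (snd ab) \<le> M")
      case True
      \<comment> \<open>Here the factor 2 enters: for an entry \<open>t \<le> 1\<close> and a
        distance \<open>d\<close>, \<open>1 + t \<le> 2 * d\<close> gives \<open>t \<le> d\<close>,
        so \<open>1 + t - d \<le> 1\<close>.\<close>
      have "x $ ab \<le> 1"
        using x by (simp add: mem_box_cart del: split_paired_All)
      then show ?thesis
        using diff[OF x, of "g (fst ab)" "g (snd ab)"] True by (simp add: f_def hg)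
    qed (simp add: f_def del: de_Morgan_conj)
    then show ?thesis
      by (simp add: mem_box_cart)
  qed
  then have "f \<in> ?Q \<rightarrow> ?Q"
    by blast
  moreover have "?Q \<noteq> {}"
    by (simp add: interval_eq_empty_cart)
  ultimately obtain x where x: "x \<in> ?Q" "f x = x"
    using brouwer[OF compact_cbox convex_box(1) _ cont] by blast
  have one: "norm (p x i - p x j) = 1" if "i < j" "j \<le> M" for i j
  proof -
    \<comment> \<open>As \<open>j \<le> M < CARD('n)\<close>, both indices are recovered by
      \<open>g\<close>; the fixed point equation then cancels the entry of \<open>x\<close>.\<close>
    have "f x $ (h i, h j) = 1 + x $ (h i, h j) - norm (p x i - p x j)"
      using that M by (simp add: f_def gh)
    then show ?thesis
      using x(2) by simp
  qed
  then have one': "norm (p x i - p x j) = 1" if "i \<noteq> j" "i \<le> M" "j \<le> M" for i j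
    using that by (metis linorder_neqE_nat norm_minus_commute)
  have "inj_on (p x) {..M}"
  proof (rule inj_onI, rule ccontr)
    fix i j assume "i \<in> {..M}" "j \<in> {..M}" "p x i = p x j" "i \<noteq> j"
    then show False
      using one'[of i j] by simp
  qed
  then have "card (p x ` {..M}) = Suc M"
    by (simp add: card_image)
  moreover have "equilateral (p x ` {..M})"
    unfolding equilateral_def
  proof (intro exI[of _ 1] conjI ballI impI)
    fix y z assume "y \<in> p x ` {..M}" "z \<in> p x ` {..M}" "y \<noteq> z"
    then obtain i j where "y = p x i" "z = p x j" "i \<le> M" "j \<le> M" "i \<noteq> j"
      by auto
    then show "norm (y - z) = 1"
      by (simp add: one')
  qed simp
  ultimately show ?thesis
    by (intro that[of "p x ` {..M}"]) auto
qed

section \<open>Lower bound for the equilateral dimension\<close>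

theorem corollary1p12:
  fixes X :: "(real ^ 'n::finite) set"
  assumes "subspace X"
    and "dim X = CARD('n) - 1"
    and "\<exists>B :: 'b::real_normed_vector set. finite B \<and> span B = UNIV"
    and "dim (UNIV :: 'b set) = CARD('n) - 1"
    and "banach_mazur_dist X infnorm (UNIV :: 'b set) norm \<le> 2"
  shows "equilateral_dim (UNIV :: 'b set) \<ge> enat (nat \<lceil>real CARD('n) / 2\<rceil>)"
proof -
  let ?M = "CARD('n) div 2"
  obtain T :: "real ^ 'n \<Rightarrow> 'b" where T: "linear T" "\<And>x. x \<in> X \<Longrightarrow> norm (T x) \<le> infnorm x"
    "\<And>x. x \<in> X \<Longrightarrow> infnorm x \<le> 2 * norm (T x)"
    using banach_mazur_attained[of X 2] assms by metis
  obtain a where X: "X = {x. a \<bullet> x = 0}"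
    using assms(1,2) dim_eq_hyperplane[of X] by (metis DIM_cart DIM_real mult.right_neutral span_eq_iff)
  obtain u :: "nat \<Rightarrow> real ^ 'n" where u: "\<And>k. k < ?M \<Longrightarrow> a \<bullet> u k = 0"
    and up: "\<And>c r. 0 \<le> r \<Longrightarrow> (\<And>k. k < ?M \<Longrightarrow> \<bar>c k\<bar> \<le> r) \<Longrightarrow>
      infnorm (\<Sum>k<?M. c k *\<^sub>R u k) \<le> r"
    and low: "\<And>c k. k < ?M \<Longrightarrow> \<bar>c k\<bar> \<le> infnorm (\<Sum>k<?M. c k *\<^sub>R u k)"
    using hyperplane_contains_linf[of a] by blast
  have mem: "(\<Sum>k<?M. c k *\<^sub>R u k) \<in> X" for c
    by (simp add: X inner_sum_right u)
  have Tsum: "(\<Sum>k<?M. c k *\<^sub>R T (u k)) = T (\<Sum>k<?M. c k *\<^sub>R u k)" for c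
    by (simp add: linear_sum[OF T(1)] linear_cmul[OF T(1)])
  obtain S :: "'b set" where S: "finite S" "card S = Suc ?M" "equilateral S"
  proof (rule equilateral_of_linf_distance_2[where 'n = 'n and v = "\<lambda>k. T (u k)" and M = ?M])
    show "?M < CARD('n)"
      by simp
    show "norm (\<Sum>k<?M. c k *\<^sub>R T (u k)) \<le> r"
      if "0 \<le> r" "\<And>k. k < ?M \<Longrightarrow> \<bar>c k\<bar> \<le> r" for c r
      unfolding Tsum using T(2)[OF mem] up[of r c] that by (meson order_trans)
    show "\<bar>c k\<bar> \<le> 2 * norm (\<Sum>k<?M. c k *\<^sub>R T (u k))" if "k < ?M" for c k
      unfolding Tsum using T(3)[OF mem] low[OF that] by (meson order_trans)
  qed
  \<comment> \<open>The extra point beyond \<open>?M\<close> is what odd dimensions need, where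
    \<open>?M\<close> is the rounded-down half.\<close>
  have "CARD('n) \<le> 2 * Suc ?M"
    by arith
  then have "real CARD('n) \<le> real (2 * Suc ?M)"
    unfolding of_nat_le_iff .
  then have "nat \<lceil>real CARD('n) / 2\<rceil> \<le> card S"
    unfolding S(2) by (simp add: nat_le_iff ceiling_le_iff)
  also have "enat (card S) \<le> equilateral_dim (UNIV :: 'b set)"
    unfolding equilateral_dim_def using S by (intro SUP_upper) simp
  finally show ?thesis
    by simp
qed

end
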